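(* Let $p$ be an odd prime, let $q,w\in\mathbb{C}_p$ with $|1-q|_p<1$ and $|1-w|_p<1$, let $x\in\mathbb{Z}_p$, and let $r\geq 1$ be an integer. Let $E_{n,w,q}^{(r)}(x)$ be the $w$-$q$-Euler polynomials of order $r$ and $G_{n,w,q}^{(r)}(x)$ the $w$-$q$-Genocchi polynomials of order $r$ (both defined in the context). Then for every integer $n\geq 0$, $$\frac{G_{n+r,w,q}^{(r)}(x)}{r!\binom{n+r}{r}}=E_{n,w,q}^{(r)}(x)=\int_{\mathbb{Z}_p}\cdots\int_{\mathbb{Z}_p}w^{x_1+\cdots+x_r}q^{-(x_1+\cdots+x_r)}[x_1+\cdots+x_r+x]_q^n\,d\mu_{-q}(x_1)\cdots d\mu_{-q}(x_r),$$ and $$G_{0,w,q}^{(r)}(x)=\cdots=G_{r-1,w,q}^{(r)}(x)=0.$$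
   Context: $\mathbb{C}_p$ is the completion of an algebraic closure of $\mathbb{Q}_p$, with absolute value normalized by $|p|_p=1/p$. For $u\in\mathbb{C}_p$ with $|1-u|_p<1$ and $y\in\mathbb{Z}_p$, $u^y=\sum_{k\ge 0}\binom{y}{k}(u-1)^k$. Notation: $[y]_q=\frac{1-q^y}{1-q}$ (with $[y]_1=y$). For a uniformly differentiable function $f:\mathbb{Z}_p\to\mathbb{C}_p$ (the difference quotient $\frac{f(y)-f(z)}{y-z}$ has a limit as $(y,z)\to(a,a)$ for every $a\in\mathbb{Z}_p$), the invariant $p$-adic $q$-integral is $$\int_{\mathbb{Z}_p}f(y)\,d\mu_{-q}(y)=\lim_{N\to\infty}\frac{1+q}{1+q^{p^N}}\sum_{y=0}^{p^N-1}f(y)(-q)^y.$$ Multiple integrals are iterated ($r$-fold). The $w$-$q$-Euler polynomials of order $r$ are defined, for $n\ge 0$, by $$E_{n,w,q}^{(r)}(x)=\int_{\mathbb{Z}_p}\cdots\int_{\mathbb{Z}_p}w^{x_1+\cdots+x_r}q^{-(x_1+\cdots+x_r)}[x_1+\cdots+x_r+x]_q^n\,d\mu_{-q}(x_1)\cdots d\mu_{-q}(x_r).$$ The $w$-$q$-Genocchi polynomials of order $r$ are defined by the following identity of formal power series in $t$ (the exponential is expanded in powers of $t$ and integrated coefficientwise): $$\sum_{n=0}^{\infty}G_{n,w,q}^{(r)}(x)\frac{t^n}{n!}=t^r\int_{\mathbb{Z}_p}\cdots\int_{\mathbb{Z}_p}w^{x_1+\cdots+x_r}q^{-(x_1+\cdots+x_r)}e^{[x_1+\cdots+x_r+x]_qt}\,d\mu_{-q}(x_1)\cdots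 d\mu_{-q}(x_r).$$ *)

theory Defs
  imports "HOL-Analysis.Analysis" "HOL-Computational_Algebra.Computational_Algebra"
begin

text \<open>
  Fields of characteristic 0 that are complete with respect to a multiplicative
  ultrametric absolute value; the metric, hence the topology, is the one it induces.
  Definiteness of the absolute value is inherited from the metric axioms. The library's
  \<open>norm\<close> is not available because it is constrained to real vector spaces.
\<close>

class complete_nonarch_field = field_char_0 + complete_space +
  fixes nonarch_abs :: "'a \<Rightarrow> real"
  assumes dist_nonarch_abs: "dist x y = nonarch_abs (x - y)"
    and nonarch_abs_mult: "nonarch_abs (x * y) = nonarch_abs x * nonarch_abs y"
    and nonarch_abs_add: "nonarch_abs (x + y) \<le> max (nonarch_abs x) (nonarch_abs y)"

text \<open>
  If the prime \<open>p\<close> has absolute value \<open>1/p\<close>, then \<^const>\<open>nonarch_abs\<close> restricts to the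
  \<open>p\<close>-adic absolute value on the rationals, so their closure in a complete field is their
  completion.
\<close>

definition Q_p :: "'a::complete_nonarch_field set" where
  "Q_p = closure \<rat>"

definition Z_p :: "'a::complete_nonarch_field set" where
  "Z_p = {x \<in> Q_p. nonarch_abs x \<le> 1}"

definition is_subfield :: "'a::field set \<Rightarrow> bool" where
  "is_subfield F \<longleftrightarrow> 0 \<in> F \<and> 1 \<in> F \<and>
     (\<forall>x\<in>F. \<forall>y\<in>F. x + y \<in> F \<and> x * y \<in> F) \<and> (\<forall>x\<in>F. - x \<in> F \<and> inverse x \<in> F)"

definition is_algebraic_closure_of :: "'a::field set \<Rightarrow> 'a set \<Rightarrow> bool" where
  "is_algebraic_closure_of F L \<longleftrightarrow>
     is_subfield F \<and> is_subfield L \<and> F \<subseteq> L \<and>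
     (\<forall>x\<in>L. \<exists>P. P \<noteq> 0 \<and> (\<forall>i. coeff P i \<in> F) \<and> poly P x = 0) \<and>
     (\<forall>P. (\<forall>i. coeff P i \<in> L) \<and> degree P > 0 \<longrightarrow> (\<exists>x\<in>L. poly P x = 0))"

text \<open>
  A type cannot depend on \<open>p\<close>, so the field of \<open>p\<close>-adic complex numbers is given by a
  predicate on types: the whole type is complete and contains an algebraic closure of
  \<^const>\<open>Q_p\<close> as a dense subfield, i.e. it is a completion of that algebraic closure, with the
  absolute value of \<open>p\<close> normalised to \<open>1/p\<close>. This determines the field up to isometric
  isomorphism.
\<close>

definition is_C_p :: "nat \<Rightarrow> 'a::complete_nonarch_field itself \<Rightarrow> bool" where
  "is_C_p p _ \<longleftrightarrow>
     prime p \<and> nonarch_abs (of_nat p :: 'a) = 1 / real p \<and>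
     (\<exists>L :: 'a set. is_algebraic_closure_of Q_p L \<and> closure L = UNIV)"

definition padic_power :: "'a::complete_nonarch_field \<Rightarrow> 'a \<Rightarrow> 'a" where
  "padic_power u y = (\<Sum>k. (y gchoose k) * (u - 1) ^ k)"

definition q_bracket :: "'a::complete_nonarch_field \<Rightarrow> 'a \<Rightarrow> 'a" where
  "q_bracket q y = (if q = 1 then y else (1 - padic_power q y) / (1 - q))"

definition uniformly_differentiable ::
    "('a::complete_nonarch_field \<Rightarrow> 'a) \<Rightarrow> bool" where
  "uniformly_differentiable f \<longleftrightarrow>
     (\<forall>a\<in>Z_p. \<exists>L. ((\<lambda>(y, z). (f y - f z) / (y - z)) \<longlongrightarrow> L)
        (at (a, a) within {(y, z). y \<in> Z_p \<and> z \<in> Z_p \<and> y \<noteq> z}))"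

definition has_q_integral ::
    "nat \<Rightarrow> 'a::complete_nonarch_field \<Rightarrow> ('a \<Rightarrow> 'a) \<Rightarrow> 'a \<Rightarrow> bool" where
  "has_q_integral p q f I \<longleftrightarrow> uniformly_differentiable f \<and>
     (\<lambda>N. (1 + q) / (1 + q ^ (p ^ N)) * (\<Sum>y<p ^ N. f (of_nat y) * (- q) ^ y))
        \<longlonglongrightarrow> I"

text \<open>As for the library's integrals, the value is 0 outside the domain of the integral.\<close>

definition q_integral ::
    "nat \<Rightarrow> 'a::complete_nonarch_field \<Rightarrow> ('a \<Rightarrow> 'a) \<Rightarrow> 'a" where
  "q_integral p q f =
     (if \<exists>I. has_q_integral p q f I then THE I. has_q_integral p q f I else 0)"

text \<open>
  The \<open>r\<close>-fold iterated integral of a function of the list \<open>[x\<^sub>1, \<dots>, x\<^sub>r]\<close>;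
  the first variable is integrated innermost, the last one outermost.
\<close>

primrec multi_q_integral ::
    "nat \<Rightarrow> 'a::complete_nonarch_field \<Rightarrow> nat \<Rightarrow> ('a list \<Rightarrow> 'a) \<Rightarrow> 'a" where
  "multi_q_integral p q 0 f = f []"
| "multi_q_integral p q (Suc r) f =
     q_integral p q (\<lambda>y. multi_q_integral p q r (\<lambda>xs. f (xs @ [y])))"

definition wq_euler ::
    "nat \<Rightarrow> nat \<Rightarrow> 'a::complete_nonarch_field \<Rightarrow> 'a \<Rightarrow> nat \<Rightarrow> 'a \<Rightarrow> 'a" where
  "wq_euler p r w q n x =
     multi_q_integral p q r (\<lambda>xs. padic_power w (sum_list xs) * padic_power q (- sum_list xs)
       * q_bracket q (sum_list xs + x) ^ n)"

text \<open>
  The right-hand side of the generating function identity; \<^term>\<open>fps_exp c\<close> is the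
  formal power series of \<open>e\<^sup>c\<^sup>t\<close>.
\<close>

definition wq_genocchi_gf ::
    "nat \<Rightarrow> nat \<Rightarrow> 'a::complete_nonarch_field \<Rightarrow> 'a \<Rightarrow> 'a \<Rightarrow> 'a fps" where
  "wq_genocchi_gf p r w q x =
     fps_X ^ r * Abs_fps (\<lambda>k. multi_q_integral p q r
       (\<lambda>xs. padic_power w (sum_list xs) * padic_power q (- sum_list xs)
         * fps_nth (fps_exp (q_bracket q (sum_list xs + x))) k))"

definition wq_genocchi ::
    "nat \<Rightarrow> nat \<Rightarrow> 'a::complete_nonarch_field \<Rightarrow> 'a \<Rightarrow> nat \<Rightarrow> 'a \<Rightarrow> 'a" where
  "wq_genocchi p r w q n x = fact n * fps_nth (wq_genocchi_gf p r w q x) n"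

lemma wq_genocchi_characterization:
  "Abs_fps (\<lambda>n. G n / fact n) = wq_genocchi_gf p r w q x \<longleftrightarrow>
   G = (\<lambda>n. wq_genocchi p r w q n x)"
  by (auto simp: fps_eq_iff fun_eq_iff wq_genocchi_def field_simps)

end

theory Submission imports Defs begin

text \<open>
  The \<open>q\<close>-integral commutes with multiplication by a nonzero constant \<open>c\<close>, also where the
  integral does not exist, because \<open>f\<close> is integrable if and only if \<open>c f\<close> is. Hence the factor
  \<open>1 / k!\<close> of the exponential series can be taken out of the iterated integral, and the
  \<open>k\<close>-th coefficient of the generating function before the shift by \<open>t\<^sup>r\<close> is \<open>1 / k!\<close> times
  the \<open>k\<close>-th Euler polynomial. The claim follows by comparing coefficients.
\<close>

text \<open>Multiplication by \<open>c\<close> scales every distance by exactly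
  \<open>nonarch_abs c\<close>, so the distance to the limit still tends to 0.\<close>

lemma tendsto_mult_left_nonarch:
  fixes c :: "'a::complete_nonarch_field"
  assumes "(g \<longlongrightarrow> L) F"
  shows "((\<lambda>x. c * g x) \<longlongrightarrow> c * L) F"
proof -
  have "dist (c * g x) (c * L) = nonarch_abs c * dist (g x) L" for x
    by (simp add: dist_nonarch_abs nonarch_abs_mult flip: right_diff_distrib)
  moreover have "((\<lambda>x. nonarch_abs c * dist (g x) L) \<longlongrightarrow> nonarch_abs c * 0) F"
    using assms by (intro tendsto_mult_left) (simp flip: tendsto_dist_iff)
  ultimately show ?thesis
    by (subst tendsto_dist_iff) simp
qed

lemma uniformly_differentiable_mult_left:
  assumes "uniformly_differentiable f"
  shows "uniformly_differentiable (\<lambda>y. c * f y)"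
  unfolding uniformly_differentiable_def
proof
  fix a :: 'a
  assume "a \<in> Z_p"
  with assms obtain L where "((\<lambda>(y, z). (f y - f z) / (y - z)) \<longlongrightarrow> L)
      (at (a, a) within {(y, z). y \<in> Z_p \<and> z \<in> Z_p \<and> y \<noteq> z})"
    unfolding uniformly_differentiable_def by blast
  from tendsto_mult_left_nonarch[OF this, of c]
  show "\<exists>L. ((\<lambda>(y, z). (c * f y - c * f z) / (y - z)) \<longlongrightarrow> L)
      (at (a, a) within {(y, z). y \<in> Z_p \<and> z \<in> Z_p \<and> y \<noteq> z})"
    by (intro exI[of _ "c * L"]) (simp add: case_prod_unfold flip: right_diff_distrib)
qed

lemma has_q_integral_mult_left:
  assumes "has_q_integral p q f I"
  shows "has_q_integral p q (\<lambda>y. c * f y) (c * I)"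
proof -
  have "(\<lambda>N. c * ((1 + q) / (1 + q ^ (p ^ N)) * (\<Sum>y<p ^ N. f (of_nat y) * (- q) ^ y)))
      \<longlonglongrightarrow> c * I"
    using assms unfolding has_q_integral_def by (intro tendsto_mult_left_nonarch) simp
  moreover have "c * ((1 + q) / (1 + q ^ (p ^ N)) * (\<Sum>y<p ^ N. f (of_nat y) * (- q) ^ y))
      = (1 + q) / (1 + q ^ (p ^ N)) * (\<Sum>y<p ^ N. c * f (of_nat y) * (- q) ^ y)" for N
    by (simp add: sum_distrib_left mult_ac)
  ultimately have "(\<lambda>N. (1 + q) / (1 + q ^ (p ^ N)) * (\<Sum>y<p ^ N. c * f (of_nat y) * (- q) ^ y))
      \<longlonglongrightarrow> c * I"
    by (simp only:)
  with assms show ?thesis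
    unfolding has_q_integral_def by (blast intro: uniformly_differentiable_mult_left)
qed

lemma q_integral_eqI:
  assumes "has_q_integral p q f I"
  shows "q_integral p q f = I"
proof -
  \<comment> \<open>Limits of sequences in a metric space are unique, so the definite description in
    \<open>q_integral\<close> picks out \<open>I\<close>.\<close>
  have "J = I" if "has_q_integral p q f J" for J
    using that assms LIMSEQ_unique unfolding has_q_integral_def by blast
  then have "(THE J. has_q_integral p q f J) = I"
    using assms by blast
  with assms show ?thesis
    unfolding q_integral_def by auto
qed

lemma q_integral_mult_left:
  assumes "c \<noteq> 0"
  shows "q_integral p q (\<lambda>y. c * f y) = c * q_integral p q f"
proof (cases "\<exists>I. has_q_integral p q f I")
  case True
  then show ?thesis
    using has_q_integral_mult_left q_integral_eqI by metis
next
  case False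
  \<comment> \<open>Scaling back by \<open>inverse c\<close> shows that \<open>c * f\<close> has no
    integral either, so both sides are built from the default value 0.\<close>
  moreover have "has_q_integral p q f (inverse c * I)"
    if "has_q_integral p q (\<lambda>y. c * f y) I" for I
    using has_q_integral_mult_left[OF that, of "inverse c"] assms
    by (simp flip: mult.assoc)
  ultimately show ?thesis
    by (auto simp: q_integral_def)
qed

text \<open>The constant leaves one integral at a time. \<open>f\<close> is generalised because the
  inner integrand varies with the outermost variable.\<close>

lemma multi_q_integral_mult_left:
  assumes "c \<noteq> 0"
  shows "multi_q_integral p q r (\<lambda>xs. c * f xs) = c * multi_q_integral p q r f"
  using assms by (induction r arbitrary: f) (simp_all add: q_integral_mult_left)

lemma wq_genocchi_gf_eq:
  "wq_genocchi_gf p r w q x = fps_X ^ r * Abs_fps (\<lambda>k. wq_euler p r w q k x / fact k)"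
proof -
  have "multi_q_integral p q r (\<lambda>xs. padic_power w (sum_list xs) * padic_power q (- sum_list xs)
      * fps_nth (fps_exp (q_bracket q (sum_list xs + x))) k) = inverse (fact k) * wq_euler p r w q k x"
    for k
    unfolding wq_euler_def
    \<comment> \<open>The factor \<open>inverse (fact k)\<close>, nonzero in characteristic 0, moves
      inside the integral, where the exponential contributes \<open>a ^ k / fact k\<close> with
      \<open>a\<close> the bracket.\<close>
    by (subst multi_q_integral_mult_left [symmetric]) (simp_all add: divide_inverse mult_ac)
  then show ?thesis
    by (simp only: wq_genocchi_gf_def divide_inverse mult.commute)
qed

theorem theorem5:
  fixes p r :: nat and q w x :: "'a::complete_nonarch_field"
  assumes "prime p" and "odd p"
    and "is_C_p p TYPE('a)"
    and "nonarch_abs (1 - q) < 1" and "nonarch_abs (1 - w) < 1"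
    and "x \<in> Z_p"
    and "r \<ge> 1"
  shows "(\<forall>n. wq_genocchi p r w q (n + r) x / (fact r * of_nat ((n + r) choose r))
              = wq_euler p r w q n x
            \<and> wq_euler p r w q n x
              = multi_q_integral p q r
                  (\<lambda>xs. padic_power w (sum_list xs) * padic_power q (- sum_list xs)
                        * q_bracket q (sum_list xs + x) ^ n))
       \<and> (\<forall>m<r. wq_genocchi p r w q m x = 0)"
proof (intro conjI allI impI)
  fix n
  have "(of_nat ((n + r) choose r) :: 'a) = fact (n + r) / (fact r * fact n)"
    by (simp add: binomial_fact)
  \<comment> \<open>After the shift by \<open>r\<close>, the numerator is
    \<open>fact (n + r) / fact n\<close> times the Euler polynomial, and the denominator is that
    same quotient of factorials.\<close>
  then show "wq_genocchi p r w q (n + r) x / (fact r * of_nat ((n + r) choose r))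
      = wq_euler p r w q n x"
    by (simp add: wq_genocchi_def wq_genocchi_gf_eq fps_X_power_mult_nth)
  show "wq_euler p r w q n x = multi_q_integral p q r
      (\<lambda>xs. padic_power w (sum_list xs) * padic_power q (- sum_list xs)
            * q_bracket q (sum_list xs + x) ^ n)"
    by (rule wq_euler_def)
next
  fix m
  assume "m < r"
  \<comment> \<open>The factor \<open>fps_X ^ r\<close> leaves no coefficient below index
    \<open>r\<close>.\<close>
  then show "wq_genocchi p r w q m x = 0"
    by (simp add: wq_genocchi_def wq_genocchi_gf_eq fps_X_power_mult_nth)
qed

end
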